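(* Let $\beta_T\approx 1.80194$ be the unique zero in $(1,2]$ of the polynomial $x^3-x^2-2x+1$, and let $\beta\in(1,\beta_T]$. Then every $x\in\left(0,\frac{1}{\beta-1}\right)$ has a simply normal $\beta$-expansion.
   Context: For $\beta\in(1,2]$ and $x\in I_\beta:=\left[0,\frac{1}{\beta-1}\right]$, a sequence $(\epsilon_i)_{i\ge1}\in\{0,1\}^{\mathbb N}$ is called a $\beta$-expansion of $x$ if $x=\sum_{i=1}^\infty \frac{\epsilon_i}{\beta^i}$. The frequency of zeros of a sequence $(\epsilon_i)\in\{0,1\}^{\mathbb N}$ is the limit $\lim_{n\to\infty}\frac{\#\{1\le i\le n:\epsilon_i=0\}}{n}$, when this limit exists. The sequence $(\epsilon_i)$ is simply normal if its frequency of zeros exists and equals $1/2$. *)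

theory Defs
  imports Complex_Main
begin

text \<open>
  A sequence indexed by the positive integers is a function on \<^typ>\<open>nat\<close> whose value at \<open>0\<close> is
  never inspected.
\<close>

definition binary_seq :: "(nat \<Rightarrow> nat) \<Rightarrow> bool" where
  "binary_seq \<epsilon> \<longleftrightarrow> (\<forall>i\<ge>1. \<epsilon> i \<in> {0, 1})"

definition beta_expansion :: "real \<Rightarrow> real \<Rightarrow> (nat \<Rightarrow> nat) \<Rightarrow> bool" where
  "beta_expansion \<beta> x \<epsilon> \<longleftrightarrow>
     binary_seq \<epsilon> \<and> (\<lambda>k. real (\<epsilon> (Suc k)) / \<beta> ^ Suc k) sums x"

text \<open>The relation holds iff the frequency of zeros exists and equals the given number.\<close>

definition has_zero_frequency :: "(nat \<Rightarrow> nat) \<Rightarrow> real \<Rightarrow> bool" where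
  "has_zero_frequency \<epsilon> d \<longleftrightarrow>
     (\<lambda>n. real (card {i. 1 \<le> i \<and> i \<le> n \<and> \<epsilon> i = 0}) / real n) \<longlonglongrightarrow> d"

definition simply_normal :: "(nat \<Rightarrow> nat) \<Rightarrow> bool" where
  "simply_normal \<epsilon> \<longleftrightarrow> has_zero_frequency \<epsilon> (1 / 2)"

definition beta_T :: real where
  "beta_T = (THE x. 1 < x \<and> x \<le> 2 \<and> x ^ 3 - x ^ 2 - 2 * x + 1 = 0)"

text \<open>The description of \<open>beta_T\<close> is proper, and the zero is the one near \<open>1.80194\<close>.\<close>

lemma beta_T_zero_gt:
  fixes x :: real
  assumes "1 < x" "x ^ 3 - x ^ 2 - 2 * x + 1 = 0"
  shows "3 / 2 < x"
proof (rule ccontr)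
  assume "\<not> 3 / 2 < x"
  then have le: "x \<le> 3 / 2" by simp
  have "x ^ 2 * (x - 1) \<le> x ^ 2 * (1 / 2)"
    using le by (intro mult_left_mono) auto
  moreover have "x ^ 2 * (x - 1) = 2 * x - 1"
    using assms(2) by (simp add: algebra_simps power2_eq_square power3_eq_cube)
  ultimately have "4 * x - 2 \<le> x ^ 2" by linarith
  moreover have "(x - 1) * (x - 3 / 2) \<le> 0"
    using assms(1) le by (intro mult_nonneg_nonpos) simp_all
  then have "x ^ 2 \<le> 5 / 2 * x - 3 / 2"
    by (simp add: field_simps power2_eq_square)
  ultimately show False
    using assms(1) by linarith
qed

lemma beta_T_zero_unique:
  fixes x y :: real
  assumes "1 < x" "x ^ 3 - x ^ 2 - 2 * x + 1 = 0"
    and "1 < y" "y ^ 3 - y ^ 2 - 2 * y + 1 = 0"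
  shows "x = y"
proof -
  have x: "3 / 2 < x" and y: "3 / 2 < y"
    by (rule beta_T_zero_gt[OF assms(1,2)], rule beta_T_zero_gt[OF assms(3,4)])
  have "(x - y) * (x * (x - 1) + y * (y - 1) + x * y - 2) =
      (x ^ 3 - x ^ 2 - 2 * x + 1) - (y ^ 3 - y ^ 2 - 2 * y + 1)"
    by (simp add: algebra_simps power2_eq_square power3_eq_cube)
  then have "(x - y) * (x * (x - 1) + y * (y - 1) + x * y - 2) = 0"
    using assms by simp
  moreover have "x * y > (3 / 2) * (3 / 2)"
    using x y by (intro mult_strict_mono) auto
  moreover have "x * (x - 1) > 0" "y * (y - 1) > 0"
    using x y by simp_all
  ultimately have "x * (x - 1) + y * (y - 1) + x * y - 2 \<noteq> 0" by linarith
  with \<open>(x - y) * _ = 0\<close> show ?thesis by simp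
qed

lemma beta_T_zero_exists:
  "\<exists>x::real. 1.80193 \<le> x \<and> x \<le> 1.80194 \<and> x ^ 3 - x ^ 2 - 2 * x + 1 = 0"
proof (rule IVT)
  show "\<forall>x::real. 1.80193 \<le> x \<and> x \<le> 1.80194 \<longrightarrow> isCont (\<lambda>x. x ^ 3 - x ^ 2 - 2 * x + 1) x"
    by (intro allI impI continuous_intros)
qed (simp_all add: power2_eq_square power3_eq_cube)

lemma beta_T_ex1: "\<exists>!x::real. 1 < x \<and> x \<le> 2 \<and> x ^ 3 - x ^ 2 - 2 * x + 1 = 0"
proof (rule ex_ex1I)
  obtain x :: real where "1.80193 \<le> x" "x \<le> 1.80194" "x ^ 3 - x ^ 2 - 2 * x + 1 = 0"
    using beta_T_zero_exists by blast
  then show "\<exists>x::real. 1 < x \<and> x \<le> 2 \<and> x ^ 3 - x ^ 2 - 2 * x + 1 = 0"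
    by (intro exI[of _ x]) simp
qed (elim conjE, rule beta_T_zero_unique)

lemma beta_T_props: "1 < beta_T" "beta_T \<le> 2" "beta_T ^ 3 - beta_T ^ 2 - 2 * beta_T + 1 = 0"
  using theI'[OF beta_T_ex1, folded beta_T_def] by simp_all

lemma beta_T_approx: "1.80193 \<le> beta_T" "beta_T \<le> 1.80194"
proof -
  obtain x :: real where x: "1.80193 \<le> x" "x \<le> 1.80194" "x ^ 3 - x ^ 2 - 2 * x + 1 = 0"
    using beta_T_zero_exists by blast
  then have "beta_T = x"
    by (intro beta_T_zero_unique[OF beta_T_props(1,3)]) simp_all
  with x show "1.80193 \<le> beta_T" "beta_T \<le> 1.80194" by simp_all
qed

end

theory Submission
  imports Defs "HOL-Real_Asymp.Real_Asymp"
begin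

text \<open>
  Put \<open>M = 1 / (\<beta> - 1)\<close> and pass to \<open>y = 2 x - M\<close>.  Expansions of \<open>x\<close> in digits \<open>0, 1\<close> become
  expansions of \<open>y\<close> in signs \<open>\<delta> = -1, 1\<close>; they are produced by iterating \<open>y \<mapsto> \<beta> y - \<delta>\<close> while
  staying in \<open>[-M, M]\<close>, and simple normality means that the discrepancy \<open>D n\<close>, the sum of the first
  \<open>n\<close> signs, is \<open>o(n)\<close>.

  The guiding observation is that the greedy algorithm, which takes the sign \<open>1\<close> whenever it can,
  cannot raise the discrepancy for long.  After a sign \<open>-1\<close> the greedy orbit lies below
  \<open>2 - M\<close>.  The hypothesis \<open>\<beta> \<le> \<beta>_T\<close> says exactly that \<open>2 - M \<le> c\<close>, where \<open>c\<close> is the point with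
  expansion \<open>+ (+ -)^\<infinity>\<close>: one step leads from \<open>c\<close> to \<open>p = 1 / (\<beta> + 1)\<close>, which lies on the
  \<open>2\<close>-cycle \<open>{p, -p}\<close>.  Hence the future signs are lexicographically at most \<open>+ (+ -)^\<infinity>\<close>,
  and their partial sums never exceed \<open>2\<close>.
  The same holds for the cautious variant that takes the sign \<open>1\<close> only for \<open>y \<ge> - max 0 t\<close>, where the
  step with sign \<open>-1\<close> maps \<open>-t\<close> to \<open>c\<close>: once \<open>y\<close> is below \<open>c\<close>, the discrepancy plus the number of the points
  \<open>-p, p\<close> below \<open>y\<close> does not increase.  So one would like to follow this rule while \<open>D > 0\<close>, and
  its mirror image while \<open>D \<le> 0\<close>.

  The obstacle is that the sign \<open>1\<close> at a point close to \<open>- (M - 1) / \<beta>\<close>, the lowest one that allows it,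
  throws \<open>y\<close> very close to \<open>-M\<close>, which forces a long run of signs \<open>-1\<close>; and \<open>t = (M - 1) / \<beta>\<close> for
  \<open>\<beta> = \<beta>_T\<close>.  The threshold \<open>max 0 t\<close> is therefore replaced at time \<open>n\<close> by \<open>thr n\<close>, which
  is at most \<open>max 0 t\<close> and tends to it.  As \<open>thr n\<close> stays at a distance of order at least \<open>1 / n\<close> from
  \<open>(M - 1) / \<beta>\<close>, the orbit keeps such a distance from the end points
  (\<open>boundary_distance_step\<close>), and forced runs have length \<open>O(log n)\<close>.
  For thresholds close to the limit the step function that counts the points \<open>-p, p\<close> below \<open>y\<close> is
  replaced by a logarithmic interpolation \<open>pot\<close>, for which \<open>D + pot\<close> grows by at most \<open>\<epsilon>\<close> in each
  step (\<open>pot_drift_plus\<close>, \<open>pot_drift_minus\<close>).  This gives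
  \<open>D n \<le> \<epsilon> n + O(log n)\<close> for every \<open>\<epsilon> > 0\<close> (\<open>discrepancy_upper_bound\<close>), and the same bound
  for \<open>- D n\<close> by symmetry.
\<close>

section \<open>Bases with balanced critical orbit\<close>

lemma cubic_nonpos_below_beta_T:
  assumes "1 < \<beta>" "\<beta> \<le> beta_T"
  shows "\<beta> ^ 3 - \<beta> ^ 2 - 2 * \<beta> + 1 \<le> 0"
proof -
  let ?b = beta_T
  have "\<beta> ^ 3 - \<beta> ^ 2 - 2 * \<beta> + 1
      = (\<beta> ^ 3 - \<beta> ^ 2 - 2 * \<beta> + 1) - (?b ^ 3 - ?b ^ 2 - 2 * ?b + 1)"
    using beta_T_props(3) by simp
  \<comment> \<open>Dividing out the root leaves a quadratic factor that is positive for all arguments from \<open>1\<close> on.\<close>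
  also have "\<dots> = (\<beta> - ?b) * (\<beta> * (\<beta> - 1) + ?b * (\<beta> - 1) + (?b * ?b - 2))"
    by (simp add: algebra_simps power2_eq_square power3_eq_cube)
  also have "\<dots> \<le> 0"
  proof (rule mult_nonpos_nonneg)
    have "1.8 * 1.8 \<le> ?b * ?b"
      using beta_T_approx(1) by (intro mult_mono) auto
    moreover have "0 \<le> \<beta> * (\<beta> - 1)" "0 \<le> ?b * (\<beta> - 1)"
      using assms beta_T_props(1) by simp_all
    ultimately show "0 \<le> \<beta> * (\<beta> - 1) + ?b * (\<beta> - 1) + (?b * ?b - 2)" by linarith
  qed (use assms in simp)
  finally show ?thesis .
qed

locale balanced_base =
  fixes \<beta> :: real
  assumes base_gt_1: "1 < \<beta>"
    and cubic_nonpos: "\<beta> ^ 3 - \<beta> ^ 2 - 2 * \<beta> + 1 \<le> 0"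
begin

text \<open>
  The attainable values of \<open>\<Sum>k. \<delta> k / \<beta> ^ Suc k\<close> with signs \<open>\<delta> k\<close> are those in \<open>[-M, M]\<close>.  The sign
  \<open>1\<close> maps \<open>c\<close> to \<open>p\<close> and \<open>p\<close> to \<open>-p\<close>, and the sign \<open>-1\<close> maps \<open>-p\<close> back to \<open>p\<close> and \<open>-t\<close> to \<open>c\<close>.
\<close>

definition M :: real where "M = 1 / (\<beta> - 1)"
definition p :: real where "p = 1 / (\<beta> + 1)"
definition c :: real where "c = (1 + p) / \<beta>"
definition t :: real where "t = (1 - c) / \<beta>"

lemma base_lt_2: "\<beta> < 2"
proof (rule ccontr)
  assume "\<not> \<beta> < 2"
  then have "0 \<le> \<beta> * ((\<beta> - 2) * (\<beta> + 1))" by simp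
  then show False
    using cubic_nonpos by (simp add: algebra_simps power2_eq_square power3_eq_cube)
qed

lemma M_fixed: "\<beta> * M = M + 1"
  using base_gt_1 by (simp add: M_def field_simps)

lemma M_gt_1: "1 < M"
  using base_gt_1 base_lt_2 by (simp add: M_def field_simps)

lemma p_pos: "0 < p" and p_cycle: "\<beta> * p = 1 - p" and c_to_p: "\<beta> * c = 1 + p"
  and t_to_c: "\<beta> * t = 1 - c"
proof -
  show "0 < p" using base_gt_1 by (simp add: p_def)
  show "\<beta> * p = 1 - p" using base_gt_1 by (simp add: p_def field_simps)
  show "\<beta> * c = 1 + p" "\<beta> * t = 1 - c" using base_gt_1 by (simp_all add: c_def t_def)
qed

lemma c_lt_M: "c < M"
proof -
  have "\<beta> * p < \<beta> * M"
    using p_pos M_gt_1 p_cycle M_fixed by linarith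
  then have "p < M"
    using base_gt_1 by simp
  then have "\<beta> * c < \<beta> * M"
    using c_to_p M_fixed by linarith
  then show ?thesis
    using base_gt_1 by simp
qed

lemma t_lt_p: "t < p"
proof -
  have "\<beta> * p < \<beta> * c"
    using p_pos p_cycle c_to_p by linarith
  then have "p < c"
    using base_gt_1 by simp
  then have "\<beta> * t < \<beta> * p"
    using t_to_c p_cycle by linarith
  then show ?thesis
    using base_gt_1 by simp
qed

text \<open>
  Here the cubic enters: its negative is a positive multiple of \<open>M - 1 - \<beta> * t\<close>.  Since
  \<open>(M - 1) / \<beta>\<close> is the largest number whose negative still allows the sign \<open>1\<close>, this says that
  switching signs at \<open>-t\<close> keeps the orbit in \<open>[-M, M]\<close>.
\<close>

lemma t_admissible: "\<beta> * t \<le> M - 1"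
proof -
  have M: "(\<beta> - 1) * M = 1" and p: "(\<beta> + 1) * p = 1"
    using base_gt_1 by (simp_all add: M_def p_def)
  have "(\<beta> + 1) * (\<beta> - 1) * \<beta> * (c + M - 2)
      = (\<beta> + 1) * (\<beta> - 1) * (\<beta> * c) + (\<beta> + 1) * \<beta> * ((\<beta> - 1) * M)
        - 2 * ((\<beta> + 1) * (\<beta> - 1) * \<beta>)"
    by (simp add: algebra_simps)
  also have "(\<beta> + 1) * (\<beta> - 1) * (\<beta> * c) = (\<beta> - 1) * (\<beta> + 1 + (\<beta> + 1) * p)"
    unfolding c_to_p by (simp add: algebra_simps)
  also have "(\<beta> - 1) * (\<beta> + 1 + (\<beta> + 1) * p) + (\<beta> + 1) * \<beta> * ((\<beta> - 1) * M)
        - 2 * ((\<beta> + 1) * (\<beta> - 1) * \<beta>) = - 2 * (\<beta> ^ 3 - \<beta> ^ 2 - 2 * \<beta> + 1)"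
    unfolding M p by (simp add: algebra_simps power2_eq_square power3_eq_cube)
  finally have "0 \<le> (\<beta> + 1) * (\<beta> - 1) * \<beta> * (c + M - 2)"
    using cubic_nonpos by simp
  moreover have "0 < (\<beta> + 1) * (\<beta> - 1) * \<beta>"
    using base_gt_1 by simp
  ultimately have "0 \<le> c + M - 2"
    by (simp only: zero_le_mult_iff) linarith
  then show ?thesis
    using t_to_c by linarith
qed

text \<open>
  For \<open>t \<le> 0\<close>, which happens for small bases, the threshold \<open>0\<close> already sends the orbit below
  \<open>c\<close> after each sign \<open>-1\<close>, because then \<open>c \<ge> 1\<close>.
\<close>

definition thr :: "nat \<Rightarrow> real" where
  "thr n = max 0 (t - 1 / (real n + 1))"

lemma thr_nonneg: "0 \<le> thr n"
  by (simp add: thr_def)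

lemma thr_lt_p: "max 0 t < p" "thr n \<le> max 0 t"
proof -
  show "max 0 t < p" using t_lt_p p_pos by simp
  have "0 \<le> 1 / (real n + 1)" by simp
  then show "thr n \<le> max 0 t" unfolding thr_def by linarith
qed

section \<open>A potential for the discrepancy\<close>

text \<open>
  A continuous replacement of the indicator function of \<open>u > 0\<close>.  It rises from \<open>0\<close> at \<open>\<eta>\<close> to \<open>1\<close>
  on a logarithmic scale, so slowly that a dilation by \<open>\<beta>\<close> raises it by at most \<open>\<epsilon>\<close>.
\<close>

definition gain :: "real \<Rightarrow> real \<Rightarrow> real \<Rightarrow> real" where
  "gain \<epsilon> \<eta> u = min 1 (\<epsilon> * log \<beta> (max 1 (u / \<eta>)))"

lemma gain_nonneg: "0 < \<epsilon> \<Longrightarrow> 0 \<le> gain \<epsilon> \<eta> u"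
  using base_gt_1 by (simp add: gain_def)

lemma gain_le_1: "gain \<epsilon> \<eta> u \<le> 1"
  by (simp add: gain_def)

lemma gain_eq_0: "0 < \<eta> \<Longrightarrow> u \<le> \<eta> \<Longrightarrow> gain \<epsilon> \<eta> u = 0"
  by (simp add: gain_def max_def)

lemma gain_eq_1:
  assumes "0 < \<epsilon>" "0 < \<eta>" "\<eta> * \<beta> powr (1 / \<epsilon>) \<le> u"
  shows "gain \<epsilon> \<eta> u = 1"
proof -
  have "\<beta> powr (1 / \<epsilon>) \<le> u / \<eta>"
    using assms by (simp add: field_simps)
  then have "\<beta> powr (1 / \<epsilon>) \<le> max 1 (u / \<eta>)"
    by simp
  then have "1 / \<epsilon> \<le> log \<beta> (max 1 (u / \<eta>))"
    using base_gt_1 by (simp add: le_log_iff)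
  then have "1 \<le> \<epsilon> * log \<beta> (max 1 (u / \<eta>))"
    using assms(1) by (simp add: field_simps)
  then show ?thesis
    by (simp add: gain_def)
qed

lemma gain_scale:
  assumes "0 < \<epsilon>" "0 < \<eta>"
  shows "gain \<epsilon> \<eta> (\<beta> * u) \<le> gain \<epsilon> \<eta> u + \<epsilon>"
proof -
  have "max 1 (\<beta> * u / \<eta>) \<le> \<beta> * max 1 (u / \<eta>)"
  proof (rule max.boundedI)
    have "1 * 1 \<le> \<beta> * max 1 (u / \<eta>)"
      using base_gt_1 by (intro mult_mono) auto
    then show "1 \<le> \<beta> * max 1 (u / \<eta>)" by simp
    have "\<beta> * (u / \<eta>) \<le> \<beta> * max 1 (u / \<eta>)"
      using base_gt_1 by (intro mult_left_mono) auto
    then show "\<beta> * u / \<eta> \<le> \<beta> * max 1 (u / \<eta>)" by simp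
  qed
  then have "log \<beta> (max 1 (\<beta> * u / \<eta>)) \<le> log \<beta> (\<beta> * max 1 (u / \<eta>))"
    using base_gt_1 by (subst log_le_cancel_iff) auto
  also have "\<dots> = 1 + log \<beta> (max 1 (u / \<eta>))"
    using base_gt_1 by (subst log_mult) auto
  finally have "\<epsilon> * log \<beta> (max 1 (\<beta> * u / \<eta>)) \<le> \<epsilon> * (1 + log \<beta> (max 1 (u / \<eta>)))"
    using assms(1) by (intro mult_left_mono) auto
  then show ?thesis
    using assms(1) by (auto simp: gain_def min_def algebra_simps)
qed

text \<open>
  An upper bound for the number of signs \<open>1\<close> needed to bring \<open>y\<close> down to \<open>d\<close>: each such sign
  multiplies the distance to the fixed point \<open>M\<close> by \<open>\<beta>\<close>.  The jump from \<open>0\<close> to \<open>1\<close> at \<open>d\<close> pays for the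
  last of these steps.
\<close>

definition escape :: "real \<Rightarrow> real \<Rightarrow> real" where
  "escape d y = (if y \<le> d then 0 else 1 + log \<beta> ((M - d) / (M - y)))"

lemma escape_ge_1:
  assumes "d < y" "y < M"
  shows "1 \<le> escape d y"
  using assms base_gt_1 by (simp add: escape_def field_simps)

lemma escape_nonneg: "y < M \<Longrightarrow> 0 \<le> escape d y"
  using escape_ge_1[of d y] by (cases "y \<le> d") (auto simp: escape_def)

lemma escape_expand:
  assumes "d < y" "y < M"
  shows "escape d (\<beta> * y - 1) + 1 \<le> escape d y"
proof (cases "\<beta> * y - 1 \<le> d")
  case True
  then show ?thesis
    using escape_ge_1[OF assms] by (simp add: escape_def)
next
  case False
  have eq: "M - (\<beta> * y - 1) = \<beta> * (M - y)"
    using M_fixed by (simp add: algebra_simps)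
  have "log \<beta> ((M - d) / (M - (\<beta> * y - 1))) = log \<beta> ((M - d) / (M - y)) - 1"
    unfolding eq using assms base_gt_1 by (simp add: log_divide log_mult)
  then show ?thesis
    using False assms by (simp add: escape_def)
qed

text \<open>
  Up to the error \<open>\<epsilon>\<close> per step, this bounds the amount by which the discrepancy can still rise
  when continuing from \<open>y\<close> by the rule for positive discrepancy: one unit for each of \<open>-p\<close> and \<open>p\<close>
  below \<open>y\<close>, and the cost of leaving the neighbourhood of \<open>M\<close>.
\<close>

definition pot :: "real \<Rightarrow> real \<Rightarrow> real \<Rightarrow> real" where
  "pot \<epsilon> \<eta> y = gain \<epsilon> \<eta> (y + p) + gain \<epsilon> \<eta> (y - p) + escape (c + \<eta> / \<beta>) y"

lemma pot_nonneg: "0 < \<epsilon> \<Longrightarrow> y < M \<Longrightarrow> 0 \<le> pot \<epsilon> \<eta> y"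
  by (simp add: pot_def gain_nonneg escape_nonneg)

text \<open>
  The map \<open>y \<mapsto> \<beta> y - 1\<close> sends \<open>p\<close> to \<open>-p\<close> and \<open>c\<close> to \<open>p\<close>.  So the term at \<open>-p\<close> inherits the old
  term at \<open>p\<close>, the full old term at \<open>-p\<close> pays for the sign, and the new term at \<open>p\<close> vanishes
  unless \<open>y\<close> was above \<open>c + \<eta> / \<beta>\<close>, in which case \<open>escape\<close> pays for it.
\<close>

lemma pot_drift_plus:
  assumes "0 < \<epsilon>" "0 < \<eta>" "y < M" and right: "\<eta> * \<beta> powr (1 / \<epsilon>) \<le> y + p"
  shows "1 + pot \<epsilon> \<eta> (\<beta> * y - 1) \<le> pot \<epsilon> \<eta> y + \<epsilon>"
proof -
  have eqs: "\<beta> * y - 1 + p = \<beta> * (y - p)" "\<beta> * y - 1 - p = \<beta> * (y - c)"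
    using p_cycle c_to_p by (simp_all add: algebra_simps)
  have "gain \<epsilon> \<eta> (\<beta> * (y - c)) + escape (c + \<eta> / \<beta>) (\<beta> * y - 1) \<le> escape (c + \<eta> / \<beta>) y"
  proof (cases "y \<le> c + \<eta> / \<beta>")
    case True
    have "\<beta> * (y - c) \<le> \<eta>"
      using True base_gt_1 by (simp add: field_simps)
    moreover have "(\<beta> - 1) * y \<le> (\<beta> - 1) * M"
      using assms(3) base_gt_1 by (intro mult_left_mono) auto
    then have "\<beta> * y - 1 \<le> y"
      using M_fixed by (simp add: algebra_simps)
    ultimately show ?thesis
      using True assms(2) by (simp add: gain_eq_0 escape_def)
  next
    case False
    then show ?thesis
      using escape_expand[of "c + \<eta> / \<beta>" y] assms(3) gain_le_1[of \<epsilon> \<eta> "\<beta> * (y - c)"] by simp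
  qed
  then show ?thesis
    using gain_scale[OF assms(1,2), of "y - p"] gain_eq_1[OF assms(1,2) right]
    unfolding pot_def eqs by simp
qed

text \<open>
  The map \<open>y \<mapsto> \<beta> y + 1\<close> sends \<open>-p\<close> to \<open>p\<close>.  So the term at \<open>p\<close> inherits the old term at \<open>-p\<close>,
  while the new term at \<open>-p\<close> is at most \<open>1\<close> and is paid for by the sign.
\<close>

lemma pot_drift_minus:
  assumes "0 < \<epsilon>" "0 < \<eta>" "y < M" and low: "\<beta> * y + 1 \<le> c + \<eta> / \<beta>"
  shows "- 1 + pot \<epsilon> \<eta> (\<beta> * y + 1) \<le> pot \<epsilon> \<eta> y + \<epsilon>"
proof -
  have eq: "\<beta> * y + 1 - p = \<beta> * (y + p)"
    using p_cycle by (simp add: algebra_simps)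
  have "escape (c + \<eta> / \<beta>) (\<beta> * y + 1) = 0"
    using low by (simp add: escape_def)
  then show ?thesis
    using gain_scale[OF assms(1,2), of "y + p"] gain_le_1[of \<epsilon> \<eta> "\<beta> * y + 1 + p"]
      gain_nonneg[OF assms(1), of \<eta> "y - p"] escape_nonneg[OF assms(3), of "c + \<eta> / \<beta>"]
    unfolding pot_def eq by simp
qed

section \<open>Sublinear discrepancy\<close>

text \<open>
  For a fixed \<open>\<epsilon>\<close> and all late times a single potential serves all thresholds, as these are then
  close enough to their limit.  While \<open>D > 0\<close> the quantity \<open>D + pot\<close> drifts upwards by at most
  \<open>\<epsilon>\<close> per step; when \<open>D \<le> 0\<close> it restarts at a value that is bounded except for \<open>escape\<close>, and
  this is logarithmic because of the distance that \<open>y\<close> keeps from \<open>M\<close>.  As the rule for the signs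
  only concerns the times with \<open>D > 0\<close>, the lemma applies to the discrepancy and to its negative alike.
\<close>

lemma discrepancy_upper_bound:
  fixes y \<delta> D :: "nat \<Rightarrow> real"
  assumes y: "\<And>n. y (Suc n) = \<beta> * y n - \<delta> n"
    and sign: "\<And>n. \<delta> n \<in> {- 1, 1}"
    and D: "D 0 = 0" "\<And>n. D (Suc n) = D n + \<delta> n"
    and greedy: "\<And>n. D n > 0 \<Longrightarrow> \<delta> n = (if - thr n \<le> y n then 1 else - 1)"
    and \<kappa>: "0 < \<kappa>" "\<And>n. \<kappa> / (real n + 1) \<le> M - y n"
    and \<epsilon>: "0 < \<epsilon>"
  shows "\<forall>\<^sub>F n in sequentially. D n \<le> \<epsilon> * real n"
proof -
  define \<epsilon>' where "\<epsilon>' = \<epsilon> / 2"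
  have \<epsilon>': "0 < \<epsilon>'" using \<epsilon> by (simp add: \<epsilon>'_def)
  \<comment> \<open>So small that the gain at \<open>-p\<close> is complete wherever the rule takes the sign \<open>1\<close>.\<close>
  define \<eta> where "\<eta> = (p - max 0 t) / \<beta> powr (1 / \<epsilon>')"
  have \<eta>: "0 < \<eta>"
    using thr_lt_p base_gt_1 by (simp add: \<eta>_def)
  have \<eta>_right: "\<eta> * \<beta> powr (1 / \<epsilon>') = p - max 0 t"
    using base_gt_1 by (simp add: \<eta>_def)
  define d where "d = c + \<eta> / \<beta>"
  \<comment> \<open>From time \<open>n0\<close> on, a sign \<open>-1\<close> taken while \<open>D > 0\<close> leads to a point that is at most \<open>d\<close>.\<close>
  obtain n0 :: nat where n0: "\<beta>\<^sup>2 / \<eta> \<le> real n0"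
    using real_arch_simple by blast
  have yM: "y n < M" for n
    using \<kappa>(2)[of n] divide_pos_pos[OF \<kappa>(1), of "real n + 1"] by linarith
  define W where "W = max 1 ((M - d) / \<kappa>)"
  define L where "L n = 1 + log \<beta> (W * (real n + 1))" for n :: nat
  have W: "1 \<le> W" by (simp add: W_def)
  have L_mono: "L n \<le> L (Suc n)" for n
    using W base_gt_1 by (simp add: L_def)
  have escape_le: "escape d (y n) \<le> L n" for n
  proof (cases "y n \<le> d")
    case True
    have "1 * 1 \<le> W * (real n + 1)" using W by (intro mult_mono) auto
    then show ?thesis using True base_gt_1 by (simp add: escape_def L_def)
  next
    case False
    have "(M - d) / (M - y n) \<le> (M - d) / (\<kappa> / (real n + 1))"
      using False \<kappa>(1) \<kappa>(2)[of n] yM[of n] by (intro divide_left_mono mult_pos_pos) auto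
    also have "\<dots> = (M - d) / \<kappa> * (real n + 1)" by simp
    also have "\<dots> \<le> W * (real n + 1)" by (intro mult_right_mono) (auto simp: W_def)
    finally have "(M - d) / (M - y n) \<le> W * (real n + 1)" .
    then have "log \<beta> ((M - d) / (M - y n)) \<le> log \<beta> (W * (real n + 1))"
      using False yM[of n] W base_gt_1 by (subst log_le_cancel_iff) auto
    then show ?thesis using False by (simp add: escape_def L_def)
  qed
  have pot_le: "pot \<epsilon>' \<eta> (y n) \<le> 2 + L n" for n
    using gain_le_1[of \<epsilon>' \<eta> "y n + p"] gain_le_1[of \<epsilon>' \<eta> "y n - p"] escape_le[of n]
    by (simp add: pot_def d_def)
  have drift: "\<delta> n + pot \<epsilon>' \<eta> (y (Suc n)) \<le> pot \<epsilon>' \<eta> (y n) + \<epsilon>'" if "D n > 0" "n0 \<le> n" for n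
  proof (cases "- thr n \<le> y n")
    case True
    then have "\<eta> * \<beta> powr (1 / \<epsilon>') \<le> y n + p"
      using thr_lt_p(2)[of n] \<eta>_right by linarith
    then show ?thesis
      using pot_drift_plus[OF \<epsilon>' \<eta> yM] greedy[OF that(1)] True by (simp add: y)
  next
    case False
    have "\<beta>\<^sup>2 / \<eta> \<le> real n + 1" using n0 that(2) by simp
    then have "1 / (real n + 1) \<le> \<eta> / \<beta>\<^sup>2"
      using \<eta> base_gt_1 by (simp add: field_simps)
    then have "t - \<eta> / \<beta>\<^sup>2 \<le> thr n" by (simp add: thr_def)
    then have "\<beta> * y n \<le> \<beta> * (\<eta> / \<beta>\<^sup>2 - t)"
      using False base_gt_1 by (intro mult_left_mono) auto
    also have "\<dots> = \<eta> / \<beta> - (1 - c)"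
      using t_to_c base_gt_1 by (simp add: algebra_simps power2_eq_square)
    finally have "\<beta> * y n + 1 \<le> c + \<eta> / \<beta>" by simp
    then show ?thesis
      using pot_drift_minus[OF \<epsilon>' \<eta> yM] greedy[OF that(1)] False by (simp add: y)
  qed
  have D_le: "D n \<le> real n" for n
  proof (induction n)
    case (Suc n)
    then show ?case using sign[of n] by (auto simp: D)
  qed (simp add: D)
  have inv: "D n + pot \<epsilon>' \<eta> (y n) \<le> real n0 + 3 + \<epsilon>' * real n + L n" if "n0 \<le> n" for n
    using that
  proof (induction n rule: dec_induct)
    case base
    have "0 \<le> \<epsilon>' * real n0" using \<epsilon>' by simp
    then show ?case using D_le[of n0] pot_le[of n0] by linarith
  next
    case (step n)
    show ?case
    proof (cases "D n > 0")
      case True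
      have "D (Suc n) + pot \<epsilon>' \<eta> (y (Suc n)) \<le> D n + pot \<epsilon>' \<eta> (y n) + \<epsilon>'"
        using drift[OF True step(1)] by (simp add: D)
      also have "\<dots> \<le> real n0 + 3 + \<epsilon>' * real n + L n + \<epsilon>'"
        using step.IH by simp
      also have "\<dots> \<le> real n0 + 3 + \<epsilon>' * real (Suc n) + L (Suc n)"
        using L_mono[of n] by (simp add: algebra_simps)
      finally show ?thesis .
    next
      case False
      then have "D (Suc n) \<le> 1" using sign[of n] by (auto simp: D)
      moreover have "0 \<le> \<epsilon>' * real (Suc n)" using \<epsilon>' by simp
      ultimately show ?thesis using pot_le[of "Suc n"] by linarith
    qed
  qed
  have lim: "(\<lambda>n. (real n0 + 3 + L n) / real n) \<longlonglongrightarrow> 0"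
    using base_gt_1 W unfolding L_def by real_asymp
  have "\<forall>\<^sub>F n in sequentially. (real n0 + 3 + L n) / real n < \<epsilon>'"
    using order_tendstoD(2)[OF lim \<epsilon>'] .
  then show ?thesis
    using eventually_ge_at_top[of "max 1 n0"]
  proof eventually_elim
    case (elim n)
    then have "real n0 + 3 + L n < \<epsilon>' * real n" by (simp add: field_simps)
    then have "D n \<le> \<epsilon>' * real n + \<epsilon>' * real n"
      using inv[of n] pot_nonneg[OF \<epsilon>' yM, of \<eta> n] elim(2) by simp
    then show ?case by (simp add: \<epsilon>'_def)
  qed
qed

section \<open>The balanced expansion\<close>

definition digit :: "nat \<Rightarrow> real \<Rightarrow> real \<Rightarrow> real" where
  "digit n y D = (if D > 0 then (if - thr n \<le> y then 1 else - 1)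
                  else (if y \<le> thr n then - 1 else 1))"

primrec orbit :: "real \<Rightarrow> nat \<Rightarrow> real \<times> real" where
  "orbit y0 0 = (y0, 0)"
| "orbit y0 (Suc n) = (let (y, D) = orbit y0 n; \<delta> = digit n y D in (\<beta> * y - \<delta>, D + \<delta>))"

text \<open>
  A sign opposite to the side of \<open>y\<close> only arises within \<open>thr n\<close> of \<open>0\<close>, and then the distance to the
  nearest end point becomes at least \<open>M - 1 - \<beta> * thr n\<close>.  Otherwise the distance to the end point
  on the side of \<open>y\<close> is multiplied by \<open>\<beta>\<close>, and the other one is at least \<open>M - 1\<close> away.
\<close>

lemma boundary_distance_step:
  assumes "\<kappa> / (real n + 1) \<le> M - \<bar>y\<bar>" "0 < \<kappa>" "\<kappa> \<le> M - 1" "\<kappa> \<le> 1"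
  shows "\<kappa> / (real (Suc n) + 1) \<le> M - \<bar>\<beta> * y - digit n y D\<bar>"
proof -
  let ?r = "\<kappa> / (real (Suc n) + 1)"
  have r1: "?r \<le> \<kappa> / (real n + 1)"
    using assms(2) by (intro divide_left_mono) auto
  then have r2: "?r \<le> M - \<bar>y\<bar>" using assms(1) by linarith
  have r3: "?r \<le> M - 1"
  proof -
    have "?r \<le> \<kappa> / 1" using assms(2) by (intro divide_left_mono) auto
    then show ?thesis using assms(3) by simp
  qed
  have r4: "?r \<le> M - 1 - \<beta> * thr n"
  proof (cases "t - 1 / (real n + 1) \<le> 0")
    case True
    then show ?thesis using r3 by (simp add: thr_def)
  next
    case False
    have "\<kappa> / (real n + 1) \<le> 1 / (real n + 1)"
      using assms(4) by (intro divide_right_mono) auto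
    also have "\<dots> \<le> \<beta> * (1 / (real n + 1))"
      using base_gt_1 by (simp add: field_simps)
    finally show ?thesis
      using False r1 t_admissible by (simp add: thr_def algebra_simps)
  qed
  have keep: "M - y \<le> M - (\<beta> * y - 1)" "M + y \<le> M + (\<beta> * y + 1)"
  proof -
    have "0 \<le> \<kappa> / (real n + 1)" using assms(2) by simp
    then have "0 \<le> (\<beta> - 1) * (M - y)" "0 \<le> (\<beta> - 1) * (M + y)"
      using assms(1) base_gt_1 by (auto intro!: mult_nonneg_nonneg)
    then show "M - y \<le> M - (\<beta> * y - 1)" "M + y \<le> M + (\<beta> * y + 1)"
      using M_fixed by (simp_all add: algebra_simps)
  qed
  have scale: "\<beta> * a \<le> \<beta> * b" if "a \<le> b" for a b
    using that base_gt_1 by simp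
  have nn: "0 \<le> \<beta> * thr n" using thr_nonneg base_gt_1 by simp
  consider "digit n y D = 1" "- thr n \<le> y" | "digit n y D = - 1" "y \<le> thr n"
    using thr_nonneg[of n] unfolding digit_def by (smt (verit))
  then show ?thesis
  proof cases
    case 1
    then show ?thesis
      using scale[OF 1(2)] keep r2 r4 by (simp add: abs_if split: if_splits)
  next
    case 2
    then show ?thesis
      using scale[OF 2(2)] keep r2 r4 by (simp add: abs_if split: if_splits)
  qed
qed

lemma balanced_sign_expansion_exists:
  assumes "\<bar>y0\<bar> < M"
  obtains \<delta> :: "nat \<Rightarrow> real" where "\<And>n. \<delta> n \<in> {- 1, 1}"
    and "(\<lambda>k. \<delta> k / \<beta> ^ Suc k) sums y0"
    and "(\<lambda>n. (\<Sum>k<n. \<delta> k) / real n) \<longlonglongrightarrow> 0"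
proof -
  define y where "y n = fst (orbit y0 n)" for n
  define D where "D n = snd (orbit y0 n)" for n
  define \<delta> where "\<delta> n = digit n (y n) (D n)" for n
  have y: "y 0 = y0" "y (Suc n) = \<beta> * y n - \<delta> n"
    and D: "D 0 = 0" "D (Suc n) = D n + \<delta> n" for n
    by (simp_all add: y_def D_def \<delta>_def Let_def split: prod.split)
  have sign: "\<delta> n \<in> {- 1, 1}" for n
    by (simp add: \<delta>_def digit_def)
  define \<kappa> where "\<kappa> = Min {M - \<bar>y0\<bar>, M - 1, 1}"
  have \<kappa>: "0 < \<kappa>" "\<kappa> \<le> M - \<bar>y0\<bar>" "\<kappa> \<le> M - 1" "\<kappa> \<le> 1"
    using assms M_gt_1 by (auto simp: \<kappa>_def)
  have dist: "\<kappa> / (real n + 1) \<le> M - \<bar>y n\<bar>" for n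
  proof (induction n)
    case 0
    then show ?case using \<kappa>(2) by (simp add: y)
  next
    case (Suc n)
    then show ?case
      using boundary_distance_step[OF Suc \<kappa>(1,3,4), of "D n"] by (simp add: y \<delta>_def)
  qed
  have y_bound: "\<bar>y n\<bar> \<le> M" for n
    using dist[of n] \<kappa>(1) by (smt (verit) divide_nonneg_nonneg of_nat_0_le_iff)
  have D_sum: "D n = (\<Sum>k<n. \<delta> k)" for n
    by (induction n) (simp_all add: D)
  have upper: "\<forall>\<^sub>F n in sequentially. D n \<le> \<epsilon> * real n" if "0 < \<epsilon>" for \<epsilon>
  proof (rule discrepancy_upper_bound[OF y(2) sign D _ \<kappa>(1) _ that])
    show "\<delta> n = (if - thr n \<le> y n then 1 else - 1)" if "D n > 0" for n
      using that by (simp add: \<delta>_def digit_def)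
    show "\<kappa> / (real n + 1) \<le> M - y n" for n
      using dist[of n] by linarith
  qed
  have lower: "\<forall>\<^sub>F n in sequentially. - D n \<le> \<epsilon> * real n" if "0 < \<epsilon>" for \<epsilon>
  proof (rule discrepancy_upper_bound[of "\<lambda>n. - y n" "\<lambda>n. - \<delta> n", OF _ _ _ _ _ \<kappa>(1) _ that])
    show "- \<delta> n = (if - thr n \<le> - y n then 1 else - 1)" if "- D n > 0" for n
      using that by (simp add: \<delta>_def digit_def)
    show "\<kappa> / (real n + 1) \<le> M - - y n" for n
      using dist[of n] by linarith
    show "- \<delta> n \<in> {- 1, 1}" for n
      using sign[of n] by auto
  qed (simp_all add: y D)
  have "(\<lambda>n. D n / real n) \<longlonglongrightarrow> 0"
  proof (rule tendstoI)
    fix e :: real assume e: "0 < e"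
    then have "0 < e / 2" by simp
    from upper[OF this] lower[OF this] eventually_gt_at_top[of "0::nat"]
    show "\<forall>\<^sub>F n in sequentially. dist (D n / real n) 0 < e"
    proof eventually_elim
      case (elim n)
      then have "\<bar>D n\<bar> \<le> e / 2 * real n" by linarith
      also have "\<dots> < e * real n" using e elim(3) by simp
      finally show ?case using elim(3) by (simp add: dist_real_def field_simps)
    qed
  qed
  moreover have "(\<lambda>k. \<delta> k / \<beta> ^ Suc k) sums y0"
  proof -
    have partial: "(\<Sum>k<n. \<delta> k / \<beta> ^ Suc k) = y0 - y n / \<beta> ^ n" for n
    proof (induction n)
      case (Suc n)
      have "y (Suc n) / \<beta> ^ Suc n = y n / \<beta> ^ n - \<delta> n / \<beta> ^ Suc n"
        using base_gt_1 by (simp add: y diff_divide_distrib)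
      then show ?case using Suc by simp
    qed (simp add: y)
    have "(\<lambda>n. M * (1 / \<beta>) ^ n) \<longlonglongrightarrow> M * 0"
      using base_gt_1 by (intro tendsto_mult tendsto_const LIMSEQ_realpow_zero) auto
    then have small: "(\<lambda>n. M * (1 / \<beta>) ^ n) \<longlonglongrightarrow> 0" by simp
    have bound: "\<bar>y n / \<beta> ^ n\<bar> \<le> M * (1 / \<beta>) ^ n" for n
      using y_bound[of n] base_gt_1 by (simp add: power_divide divide_right_mono)
    have "(\<lambda>n. \<bar>y n / \<beta> ^ n\<bar>) \<longlonglongrightarrow> 0"
    proof (rule tendsto_sandwich[OF _ _ tendsto_const small])
      show "\<forall>\<^sub>F n in sequentially. 0 \<le> \<bar>y n / \<beta> ^ n\<bar>"
        by (rule always_eventually) simp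
      show "\<forall>\<^sub>F n in sequentially. \<bar>y n / \<beta> ^ n\<bar> \<le> M * (1 / \<beta>) ^ n"
        by (rule always_eventually) (rule allI, rule bound)
    qed
    then have "(\<lambda>n. y n / \<beta> ^ n) \<longlonglongrightarrow> 0"
      by (rule tendsto_rabs_zero_cancel)
    then have "(\<lambda>n. y0 - y n / \<beta> ^ n) \<longlonglongrightarrow> y0 - 0"
      by (intro tendsto_diff tendsto_const)
    then show ?thesis
      by (simp only: sums_def partial diff_zero)
  qed
  ultimately show ?thesis
    using that[of \<delta>] sign by (simp add: D_sum)
qed

end

section \<open>Simply normal expansions\<close>

theorem theorem1p3:
  fixes \<beta> :: real
  assumes "\<beta> \<in> {1<..beta_T}"
  shows "\<forall>x \<in> {0<..<1 / (\<beta> - 1)}. \<exists>\<epsilon>. beta_expansion \<beta> x \<epsilon> \<and> simply_normal \<epsilon>"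
proof
  fix x assume x: "x \<in> {0<..<1 / (\<beta> - 1)}"
  interpret balanced_base \<beta>
    using assms cubic_nonpos_below_beta_T by unfold_locales auto
  have "\<bar>2 * x - M\<bar> < M"
    using x by (auto simp: M_def)
  then obtain \<delta> :: "nat \<Rightarrow> real" where sign: "\<And>n. \<delta> n \<in> {- 1, 1}"
    and \<delta>_sums: "(\<lambda>k. \<delta> k / \<beta> ^ Suc k) sums (2 * x - M)"
    and mean: "(\<lambda>n. (\<Sum>k<n. \<delta> k) / real n) \<longlonglongrightarrow> 0"
    using balanced_sign_expansion_exists by blast
  define \<epsilon> :: "nat \<Rightarrow> nat" where "\<epsilon> i = (if \<delta> (i - 1) = 1 then 1 else 0)" for i
  have \<epsilon>_\<delta>: "real (\<epsilon> (Suc k)) = (\<delta> k + 1) / 2" for k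
    using sign[of k] by (auto simp: \<epsilon>_def)
  have "(\<lambda>k. (1 / \<beta>) ^ k) sums (1 / (1 - 1 / \<beta>))"
    using base_gt_1 by (intro geometric_sums) auto
  then have "(\<lambda>k. 1 / \<beta> * (1 / \<beta>) ^ k) sums (1 / \<beta> * (1 / (1 - 1 / \<beta>)))"
    by (rule sums_mult)
  moreover have "1 / \<beta> * (1 / (1 - 1 / \<beta>)) = M"
    using base_gt_1 by (simp add: M_def field_simps)
  ultimately have "(\<lambda>k. 1 / \<beta> ^ Suc k) sums M"
    by (simp add: power_divide)
  from sums_divide[OF sums_add[OF \<delta>_sums this], of 2]
  have "(\<lambda>k. real (\<epsilon> (Suc k)) / \<beta> ^ Suc k) sums x"
    by (simp add: \<epsilon>_\<delta> add_divide_distrib mult.commute)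
  then have expansion: "beta_expansion \<beta> x \<epsilon>"
    by (simp add: beta_expansion_def binary_seq_def \<epsilon>_def)
  have zeros: "real (card {i. 1 \<le> i \<and> i \<le> n \<and> \<epsilon> i = 0}) = (real n - (\<Sum>k<n. \<delta> k)) / 2" for n
  proof (induction n)
    case (Suc n)
    have fin: "finite {i. 1 \<le> i \<and> i \<le> n \<and> \<epsilon> i = 0}" by simp
    have split: "{i. 1 \<le> i \<and> i \<le> Suc n \<and> \<epsilon> i = 0} =
      (if \<delta> n = 1 then {} else {Suc n}) \<union> {i. 1 \<le> i \<and> i \<le> n \<and> \<epsilon> i = 0}"
      by (auto simp: \<epsilon>_def le_Suc_eq)
    show ?case
      unfolding split using sign[of n] Suc fin by (auto simp: field_simps)
  qed simp
  have "(\<lambda>n. 1 / 2 - (\<Sum>k<n. \<delta> k) / real n / 2) \<longlonglongrightarrow> 1 / 2 - 0 / 2"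
    by (intro tendsto_intros mean) simp
  then have half: "(\<lambda>n. 1 / 2 - (\<Sum>k<n. \<delta> k) / real n / 2) \<longlonglongrightarrow> 1 / 2"
    by simp
  have "simply_normal \<epsilon>"
    unfolding simply_normal_def has_zero_frequency_def zeros
  proof (rule Lim_transform_eventually[OF half])
    show "\<forall>\<^sub>F n in sequentially. 1 / 2 - (\<Sum>k<n. \<delta> k) / real n / 2
        = (real n - (\<Sum>k<n. \<delta> k)) / 2 / real n"
      using eventually_gt_at_top[of "0::nat"]
      by eventually_elim (simp add: field_simps)
  qed
  with expansion show "\<exists>\<epsilon>. beta_expansion \<beta> x \<epsilon> \<and> simply_normal \<epsilon>" by blast
qed

end
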